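(* Let $H=(V,E)$ be a directed $m$-uniform hypergraph on $n$ vertices with out-adjacency hypermatrix $A_H^+$, and let $\delta^+=d_1^+\le d_2^+\le\dots\le d_{n-1}^+\le d_n^+=\Delta^+$ be the out-degrees of its vertices arranged in non-decreasing order. Then $$(\delta^+)^{\frac1m}(d_2^+)^{1-\frac1m}\le\rho(A_H^+)\le(\Delta^+)^{\frac1m}(d_{n-1}^+)^{1-\frac1m}.$$
   Context: $M_{m,n}$ is the set of real hypermatrices (tensors) $A=(a_{i_1i_2\dots i_m})$, $1\le i_1,\dots,i_m\le n$. For a vector $x$, $Ax^{m-1}$ is the vector with $i$-th entry $\sum_{i_2,\dots,i_m=1}^n a_{ii_2\dots i_m}x_{i_2}\cdots x_{i_m}$, and $x^{[m-1]}$ is the vector with $i$-th entry $x_i^{m-1}$. $\lambda\in\mathbb C$ is an eigenvalue of (nonzero) $A$ if $Ax^{m-1}=\lambda x^{[m-1]}$ for some $x\in\mathbb C^n\setminus\{0\}$. $\rho(A)=\max\{|\lambda|:\lambda\text{ is an eigenvalue of }A\}$. A directed hypergraph $H=(V,E)$ has a finite vertex set $V=\{v_1,\dots,v_n\}$ and a set $E$ of edges; each edge $e$ is a subset of $V$ with a partition $e=T_e\sqcup H_e$ into a nonempty tail $T_e$ and a nonempty head $H_e$, and distinct edges $e_1\ne e_2$ satisfy $T_{e_1}\cup H_{e_1}\neq T_{e_2}\cup H_{e_2}$. It is $m$-uniform if $|e|=m$ for all $e\in E$. The out-degree of $v$ is $d_v^+=|\{e\in E: v\in T_e\}|$; $\delta^+$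 and $\Delta^+$ are the smallest and largest out-degrees. Out-adjacency hypermatrix $A_H^+=(a^+_{i_1\dots i_m})\in M_{m,n}$ of a directed $m$-uniform hypergraph: for each edge $e$ with $|T_e|=k$, $a^+_{i_1\dots i_m}=\frac{1}{(m-k)!\,(k-1)!}$ whenever $(v_{i_1},\dots,v_{i_k})$ is an ordering of all the elements of $T_e$ and $(v_{i_{k+1}},\dots,v_{i_m})$ is an ordering of all the elements of $H_e$; all other entries are $0$. *)

theory Defs
  imports "HOL-Analysis.Analysis" "HOL-Combinatorics.Multiset_Permutations"
begin

text \<open>
  A hypermatrix of order \<open>m\<close> and dimension \<open>n = CARD('n)\<close> is a real-valued function on index
  lists over the finite type \<open>'n\<close>; only its values on lists of length \<open>m\<close> are ever used.
\<close>

type_synonym 'n hypermatrix = "'n list \<Rightarrow> real"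

definition hm_apply :: "nat \<Rightarrow> 'n::finite hypermatrix \<Rightarrow> complex ^ 'n \<Rightarrow> complex ^ 'n" where
  "hm_apply m A x =
     (\<chi> i. \<Sum>js | length js = m - 1. complex_of_real (A (i # js)) * (\<Prod>j\<leftarrow>js. x $ j))"

definition vec_power :: "complex ^ 'n::finite \<Rightarrow> nat \<Rightarrow> complex ^ 'n" where
  "vec_power x k = (\<chi> i. (x $ i) ^ k)"

definition hm_eigenvalue :: "nat \<Rightarrow> 'n::finite hypermatrix \<Rightarrow> complex \<Rightarrow> bool" where
  "hm_eigenvalue m A l \<longleftrightarrow> (\<exists>x. x \<noteq> 0 \<and> hm_apply m A x = l *s vec_power x (m - 1))"

text \<open>
  \<^const>\<open>Max\<close> is only meaningful on finite sets, so the maximum is taken with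
  \<^const>\<open>Greatest\<close>, which requires it to be attained but not that there are finitely many
  eigenvalues.
\<close>

definition hm_spectral_radius :: "nat \<Rightarrow> 'n::finite hypermatrix \<Rightarrow> real" where
  "hm_spectral_radius m A = (GREATEST r. \<exists>l. hm_eigenvalue m A l \<and> r = cmod l)"

text \<open>
  The vertices are the elements of the finite type \<open>'n\<close>, and an edge is the pair \<open>(T, H)\<close>
  of its tail and its head, so that the edge as a set of vertices is \<open>T \<union> H\<close>.
\<close>

type_synonym 'n dedge = "'n set \<times> 'n set"

definition directed_hypergraph :: "'n::finite dedge set \<Rightarrow> bool" where
  "directed_hypergraph E \<longleftrightarrow>
     (\<forall>(T, H) \<in> E. T \<noteq> {} \<and> H \<noteq> {} \<and> T \<inter> H = {}) \<and>
     (\<forall>e1 \<in> E. \<forall>e2 \<in> E. e1 \<noteq> e2 \<longrightarrow> fst e1 \<union> snd e1 \<noteq> fst e2 \<union> snd e2)"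

definition uniform_hypergraph :: "nat \<Rightarrow> 'n::finite dedge set \<Rightarrow> bool" where
  "uniform_hypergraph m E \<longleftrightarrow> (\<forall>(T, H) \<in> E. card (T \<union> H) = m)"

definition out_degree :: "'n::finite dedge set \<Rightarrow> 'n \<Rightarrow> nat" where
  "out_degree E v = card {(T, H) \<in> E. v \<in> T}"

definition min_out_degree :: "'n::finite dedge set \<Rightarrow> nat" where
  "min_out_degree E = Min (range (out_degree E))"

definition max_out_degree :: "'n::finite dedge set \<Rightarrow> nat" where
  "max_out_degree E = Max (range (out_degree E))"

text \<open>
  The \<open>j\<close>-th smallest out-degree, counted with multiplicity, for \<open>1 \<le> j \<le> CARD('n)\<close>.
\<close>

definition nth_out_degree :: "'n::finite dedge set \<Rightarrow> nat \<Rightarrow> nat" where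
  "nth_out_degree E j =
     sorted_list_of_multiset (image_mset (out_degree E) (mset_set UNIV)) ! (j - 1)"

definition matches_edge :: "'n list \<Rightarrow> 'n dedge \<Rightarrow> bool" where
  "matches_edge xs e \<longleftrightarrow>
     take (card (fst e)) xs \<in> permutations_of_set (fst e) \<and>
     drop (card (fst e)) xs \<in> permutations_of_set (snd e)"

text \<open>
  At most one summand is nonzero, since a list matching an edge \<open>(T, H)\<close> determines the set
  \<open>T \<union> H\<close> and hence the edge; see \<open>out_adjacency_edge\<close> below.
\<close>

definition out_adjacency :: "nat \<Rightarrow> 'n::finite dedge set \<Rightarrow> 'n hypermatrix" where
  "out_adjacency m E xs =
     (\<Sum>e\<in>E. if matches_edge xs e
            then 1 / (fact (m - card (fst e)) * fact (card (fst e) - 1)) else 0)"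

lemma matches_edge_set:
  assumes "matches_edge xs e"
  shows "set xs = fst e \<union> snd e"
proof -
  have "set xs = set (take (card (fst e)) xs) \<union> set (drop (card (fst e)) xs)"
    by (metis append_take_drop_id set_append)
  with assms show ?thesis
    by (simp add: matches_edge_def permutations_of_set_def)
qed

lemma out_adjacency_edge:
  assumes "directed_hypergraph E" "e \<in> E" "matches_edge xs e"
  shows "out_adjacency m E xs = 1 / (fact (m - card (fst e)) * fact (card (fst e) - 1))"
proof -
  have "e' = e" if "e' \<in> E" "matches_edge xs e'" for e'
  proof -
    have "fst e' \<union> snd e' = fst e \<union> snd e"
      using matches_edge_set[OF that(2)] matches_edge_set[OF assms(3)] by (rule trans[OF sym])
    with that(1) assms(1,2) show ?thesis
      unfolding directed_hypergraph_def by blast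
  qed
  then have "out_adjacency m E xs =
      (\<Sum>e'\<in>E. if e' = e then 1 / (fact (m - card (fst e)) * fact (card (fst e) - 1)) else 0)"
    unfolding out_adjacency_def using assms(3) by (intro sum.cong refl) metis
  also have "\<dots> = 1 / (fact (m - card (fst e)) * fact (card (fst e) - 1))"
    using assms(2) by simp
  finally show ?thesis .
qed

lemma out_adjacency_no_edge:
  assumes "\<And>e. e \<in> E \<Longrightarrow> \<not> matches_edge xs e"
  shows "out_adjacency m E xs = 0"
  using assms by (simp add: out_adjacency_def)

end

theory Submission
  imports Defs
begin

text \<open>
  The factorials in the out-adjacency hypermatrix are chosen so that the \<open>i\<close>-th entry of
  \<open>A x\<^sup>m\<^sup>-\<^sup>1\<close> is the sum, over the edges \<open>e\<close> with \<open>i\<close> in their tail, of the product of the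
  \<open>x\<^sub>j\<close> with \<open>j \<in> e - {i}\<close> (\<open>hm_apply_out_adjacency\<close>). There are \<open>d\<^sub>i\<close> such edges, each
  contributing a product of \<open>m - 1\<close> distinct coordinates other than \<open>x\<^sub>i\<close>.
  
  For the upper bound, take an eigenvector \<open>x\<close> with eigenvalue \<open>l\<close>, and let \<open>p\<close> and \<open>q\<close> be the
  indices of its largest and second largest coordinate in modulus. Bounding all factors in
  equation \<open>p\<close> by \<open>\<bar>x\<^sub>q\<bar>\<close>, and those in equation \<open>q\<close> by \<open>\<bar>x\<^sub>q\<bar>\<close> except for one factor \<open>\<bar>x\<^sub>p\<bar>\<close>, gives
  \<open>\<bar>l\<bar> \<bar>x\<^sub>p\<bar>\<^sup>m\<^sup>-\<^sup>1 \<le> d\<^sub>p \<bar>x\<^sub>q\<bar>\<^sup>m\<^sup>-\<^sup>1\<close> and \<open>\<bar>l\<bar> \<bar>x\<^sub>q\<bar> \<le> d\<^sub>q \<bar>x\<^sub>p\<bar>\<close>. Eliminating the ratio of the two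
  coordinates gives \<open>\<bar>l\<bar>\<^sup>m \<le> d\<^sub>p d\<^sub>q\<^sup>m\<^sup>-\<^sup>1\<close>. This suffices unless \<open>q\<close> is the only vertex whose degree
  exceeds the second largest one; but then \<open>\<bar>l\<bar> \<le> d\<^sub>p\<close>, which also follows from equation \<open>p\<close>, is
  enough (\<open>degree_product_le\<close>, \<open>eigenvalue_power_le\<close>).
  
  For the lower bound the same argument runs with the inequalities reversed and the two smallest
  coordinates, for any \<open>x\<close> with all \<open>x\<^sub>i > 0\<close> and \<open>A x\<^sup>m\<^sup>-\<^sup>1 \<le> l x\<^sup>[\<^sup>m\<^sup>-\<^sup>1\<^sup>]\<close>
  (\<open>positive_supersolution_power_ge\<close>). Such a vector need not exist with \<open>l\<close> an eigenvalue when
  the hypergraph is not connected enough, so a constant \<open>c > 0\<close> is added to each coordinate of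
  \<open>A x\<^sup>m\<^sup>-\<^sup>1\<close>. Brouwer's theorem on the standard simplex then yields a positive solution
  (\<open>perturbed_positive_eigenvector\<close>), and along a sequence with \<open>c \<rightarrow> 0\<close> these solutions accumulate
  at a genuine nonnegative eigenvector whose eigenvalue satisfies the bound
  (\<open>exists_large_eigenvalue\<close>).
  
  Finally, normalised eigenpairs form a compact set, so the spectral radius is the modulus of an
  actual eigenvalue and both bounds apply to it (\<open>spectral_radius_attained\<close>). If \<open>m = 1\<close>, there are
  no edges and everything vanishes.
\<close>

section \<open>The eigenvalue equation in terms of edges\<close>

text \<open>
  The ring is left open because the same polynomial is evaluated at a complex eigenvector, at the
  moduli of its coordinates, and at real vectors.
\<close>

definition edge_poly :: "'n::finite dedge set \<Rightarrow> ('n \<Rightarrow> 'a::comm_semiring_1) \<Rightarrow> 'n \<Rightarrow> 'a" where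
  "edge_poly E x i = (\<Sum>e\<in>{e\<in>E. i \<in> fst e}. \<Prod>j\<in>fst e \<union> snd e - {i}. x j)"

lemma out_degree_eq_card: "out_degree E v = card {e\<in>E. v \<in> fst e}"
  unfolding out_degree_def by (rule arg_cong[of _ _ card]) auto

text \<open>
  Fixing the first index to be a tail vertex leaves an ordering of the rest of the tail followed
  by an ordering of the head. Their number cancels the factorials in the matrix entries.
\<close>

lemma matching_lists_of_edge:
  fixes T H :: "'n::finite set"
  assumes "i \<in> T"
  shows "{js. matches_edge (i # js) (T, H)}
       = (\<lambda>(us, vs). us @ vs) ` (permutations_of_set (T - {i}) \<times> permutations_of_set H)"
    (is "?L = ?R")
proof
  have T: "card T = Suc (card (T - {i}))"
    using assms by (metis card.remove finite)
  show "?L \<subseteq> ?R"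
  proof
    fix js assume "js \<in> ?L"
    then have m: "i # take (card (T - {i})) js \<in> permutations_of_set T"
      "drop (card (T - {i})) js \<in> permutations_of_set H"
      using T by (auto simp: matches_edge_def)
    then have "take (card (T - {i})) js \<in> permutations_of_set (T - {i})"
      by (auto simp: permutations_of_set_def)
    with m(2) show "js \<in> ?R"
      by (intro image_eqI[where x = "(take (card (T - {i})) js, drop (card (T - {i})) js)"]) auto
  qed
  show "?R \<subseteq> ?L"
  proof
    fix js assume "js \<in> ?R"
    then obtain us vs where js: "js = us @ vs" "us \<in> permutations_of_set (T - {i})"
      "vs \<in> permutations_of_set H" by auto
    then have "take (card T) (i # js) = i # us" "drop (card T) (i # js) = vs"
      unfolding T by (simp_all add: length_finite_permutations_of_set)
    with js assms show "js \<in> ?L"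
      by (auto simp: matches_edge_def permutations_of_set_def)
  qed
qed

lemma card_matching_lists_of_edge:
  fixes T H :: "'n::finite set"
  assumes "i \<in> T"
  shows "card {js. matches_edge (i # js) (T, H)} = fact (card T - 1) * fact (card H)"
proof -
  have "inj_on (\<lambda>(us, vs). us @ vs) (permutations_of_set (T - {i}) \<times> permutations_of_set H)"
    by (auto simp: inj_on_def dest!: length_finite_permutations_of_set)
  then show ?thesis
    unfolding matching_lists_of_edge[OF assms]
    by (subst card_image) (simp_all add: card_cartesian_product card_Diff_singleton assms)
qed

text \<open>
  All lists counted here run once through \<open>T \<union> H - {i}\<close> and so contribute the same monomial. For
  \<open>i \<notin> T\<close> there are none, because the first entry of a matching list belongs to the nonempty
  tail.
\<close>

lemma sum_matching_lists_of_edge: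
  fixes x :: "'n::finite \<Rightarrow> complex"
  assumes "T \<noteq> {}" "T \<inter> H = {}" "card (T \<union> H) = m"
  shows "(\<Sum>js | length js = m - 1. if matches_edge (i # js) (T, H)
           then (\<Prod>j\<leftarrow>js. x j) / (fact (m - card T) * fact (card T - 1)) else 0)
       = (if i \<in> T then \<Prod>j\<in>T \<union> H - {i}. x j else 0)"
proof (cases "i \<in> T")
  case False
  have "\<not> matches_edge (i # js) (T, H)" for js
  proof
    assume "matches_edge (i # js) (T, H)"
    then have "set (take (card T) (i # js)) = T"
      by (simp add: matches_edge_def permutations_of_set_def)
    moreover have "card T \<noteq> 0" using assms(1) by simp
    ultimately show False using False by (cases "card T") auto
  qed
  then show ?thesis using False by simp
next
  case True
  let ?M = "{js. matches_edge (i # js) (T, H)}"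
  have cH: "m - card T = card H"
    using assms(2,3) by (simp add: card_Un_disjoint)
  have fin: "finite {js :: 'n list. length js = m - 1}"
    using finite_lists_length_eq[of "UNIV :: 'n set" "m - 1"] by simp
  have M: "length js = m - 1 \<and> (\<Prod>j\<leftarrow>js. x j) = (\<Prod>j\<in>T \<union> H - {i}. x j)" if "js \<in> ?M" for js
  proof -
    from that obtain us vs where js: "js = us @ vs" "us \<in> permutations_of_set (T - {i})"
      "vs \<in> permutations_of_set H"
      unfolding matching_lists_of_edge[OF True] by auto
    then have s: "set js = T \<union> H - {i}" "distinct js"
      using assms(2) True by (auto simp: permutations_of_set_def)
    have "length js = card (T \<union> H - {i})" using s by (metis distinct_card)
    then show ?thesis using s assms(3) True
      by (simp add: prod.distinct_set_conv_list[symmetric])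
  qed
  have "(\<Sum>js | length js = m - 1. if matches_edge (i # js) (T, H)
           then (\<Prod>j\<leftarrow>js. x j) / (fact (m - card T) * fact (card T - 1)) else 0)
      = (\<Sum>js\<in>?M. (\<Prod>j\<leftarrow>js. x j) / (fact (m - card T) * fact (card T - 1)))"
    using M by (intro sum.mono_neutral_cong_right fin) auto
  also have "\<dots> = (\<Sum>js\<in>?M. (\<Prod>j\<in>T \<union> H - {i}. x j) / (fact (m - card T) * fact (card T - 1)))"
    using M by (intro sum.cong) auto
  also have "\<dots> = (\<Prod>j\<in>T \<union> H - {i}. x j)"
    by (simp add: card_matching_lists_of_edge[OF True] cH)
  finally show ?thesis using True by simp
qed

lemma hm_apply_out_adjacency:
  assumes "directed_hypergraph E" "uniform_hypergraph m E"
  shows "hm_apply m (out_adjacency m E) x $ i = edge_poly E (\<lambda>j. x $ j) i"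
proof -
  have "hm_apply m (out_adjacency m E) x $ i
      = (\<Sum>js | length js = m - 1. \<Sum>e\<in>E. if matches_edge (i # js) e
           then (\<Prod>j\<leftarrow>js. x $ j) / (fact (m - card (fst e)) * fact (card (fst e) - 1)) else 0)"
    unfolding hm_apply_def out_adjacency_def
    by (auto simp: sum_distrib_right intro!: sum.cong)
  also have "\<dots> = (\<Sum>e\<in>E. \<Sum>js | length js = m - 1. if matches_edge (i # js) e
           then (\<Prod>j\<leftarrow>js. x $ j) / (fact (m - card (fst e)) * fact (card (fst e) - 1)) else 0)"
    by (rule sum.swap)
  also have "\<dots> = (\<Sum>e\<in>E. if i \<in> fst e then \<Prod>j\<in>fst e \<union> snd e - {i}. x $ j else 0)"
  proof (rule sum.cong[OF refl])
    fix e assume e: "e \<in> E"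
    obtain T H where TH: "e = (T, H)" by (cases e)
    have "T \<noteq> {}" "T \<inter> H = {}" "card (T \<union> H) = m"
      using assms e TH by (auto simp: directed_hypergraph_def uniform_hypergraph_def)
    from sum_matching_lists_of_edge[OF this, of i "\<lambda>j. x $ j"]
    show "(\<Sum>js | length js = m - 1. if matches_edge (i # js) e
           then (\<Prod>j\<leftarrow>js. x $ j) / (fact (m - card (fst e)) * fact (card (fst e) - 1)) else 0)
        = (if i \<in> fst e then \<Prod>j\<in>fst e \<union> snd e - {i}. x $ j else 0)"
      unfolding TH fst_conv snd_conv .
  qed
  also have "\<dots> = edge_poly E (\<lambda>j. x $ j) i"
    unfolding edge_poly_def by (simp add: sum.inter_filter)
  finally show ?thesis .
qed

lemma hm_eigenvalue_out_adjacency_iff: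
  assumes "directed_hypergraph E" "uniform_hypergraph m E"
  shows "hm_eigenvalue m (out_adjacency m E) l
     \<longleftrightarrow> (\<exists>x. x \<noteq> 0 \<and> (\<forall>i. edge_poly E (\<lambda>j. x $ j) i = l * (x $ i) ^ (m - 1)))"
  unfolding hm_eigenvalue_def vec_eq_iff hm_apply_out_adjacency[OF assms]
  by (simp add: vec_power_def)

lemma norm_edge_poly_le:
  fixes x :: "'n::finite \<Rightarrow> 'a::{real_normed_field}"
  shows "norm (edge_poly E x i) \<le> edge_poly E (\<lambda>j. norm (x j)) i"
  unfolding edge_poly_def by (rule sum_norm_le) (simp add: prod_norm)

lemma edge_poly_of_real:
  "edge_poly E (\<lambda>j. of_real (x j) :: 'a::{real_algebra_1,comm_semiring_1}) i = of_real (edge_poly E x i)"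
  by (simp add: edge_poly_def)

lemma edge_poly_nonneg:
  fixes x :: "'n::finite \<Rightarrow> real"
  assumes "\<And>j. x j \<ge> 0"
  shows "edge_poly E x i \<ge> 0"
  unfolding edge_poly_def by (intro sum_nonneg prod_nonneg) (simp add: assms)

lemma tendsto_edge_poly:
  fixes f :: "'b \<Rightarrow> 'n::finite \<Rightarrow> 'a::real_normed_field"
  assumes "\<And>j. ((\<lambda>t. f t j) \<longlongrightarrow> x j) F"
  shows "((\<lambda>t. edge_poly E (f t) i) \<longlongrightarrow> edge_poly E x i) F"
  unfolding edge_poly_def by (intro tendsto_sum tendsto_prod assms)

lemma continuous_on_edge_poly:
  fixes f :: "'b::topological_space \<Rightarrow> 'n::finite \<Rightarrow> 'a::real_normed_field"
  assumes "\<And>j. continuous_on S (\<lambda>t. f t j)"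
  shows "continuous_on S (\<lambda>t. edge_poly E (f t) i)"
  unfolding edge_poly_def by (intro continuous_intros assms)

text \<open>
  Uniformity makes the polynomial homogeneous, which allows eigenvectors to be normalised.
\<close>

lemma edge_poly_scale:
  assumes "uniform_hypergraph m E"
  shows "edge_poly E (\<lambda>j. c * x j) i = c ^ (m - 1) * edge_poly E x i"
  unfolding edge_poly_def sum_distrib_left
proof (rule sum.cong[OF refl])
  fix e assume e: "e \<in> {e \<in> E. i \<in> fst e}"
  then have "card (fst e \<union> snd e - {i}) = m - 1"
    using assms by (auto simp: uniform_hypergraph_def)
  then show "(\<Prod>j\<in>fst e \<union> snd e - {i}. c * x j) = c ^ (m - 1) * (\<Prod>j\<in>fst e \<union> snd e - {i}. x j)"
    by (simp add: prod.distrib)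
qed

text \<open>
  Together with \<open>edge_poly_ge\<close>, this reduces the estimates to one product of \<open>m - 1\<close> coordinates:
  the index \<open>i\<close> itself is never a factor, and out-degree many edges contribute.
\<close>

lemma edge_poly_le:
  fixes x :: "'n::finite \<Rightarrow> real"
  assumes "uniform_hypergraph m E"
    and "\<And>R. card R = m - 1 \<Longrightarrow> i \<notin> R \<Longrightarrow> (\<Prod>j\<in>R. x j) \<le> K"
  shows "edge_poly E x i \<le> real (out_degree E i) * K"
  unfolding edge_poly_def out_degree_eq_card
proof (rule sum_bounded_above)
  fix e assume e: "e \<in> {e \<in> E. i \<in> fst e}"
  then have "card (fst e \<union> snd e - {i}) = m - 1"
    using assms(1) by (auto simp: uniform_hypergraph_def)
  then show "(\<Prod>j\<in>fst e \<union> snd e - {i}. x j) \<le> K"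
    by (rule assms(2)) simp
qed

lemma edge_poly_ge:
  fixes x :: "'n::finite \<Rightarrow> real"
  assumes "uniform_hypergraph m E"
    and "\<And>R. card R = m - 1 \<Longrightarrow> i \<notin> R \<Longrightarrow> K \<le> (\<Prod>j\<in>R. x j)"
  shows "real (out_degree E i) * K \<le> edge_poly E x i"
  unfolding edge_poly_def out_degree_eq_card
proof (rule sum_bounded_below)
  fix e assume e: "e \<in> {e \<in> E. i \<in> fst e}"
  then have "card (fst e \<union> snd e - {i}) = m - 1"
    using assms(1) by (auto simp: uniform_hypergraph_def)
  then show "K \<le> (\<Prod>j\<in>fst e \<union> snd e - {i}. x j)"
    by (rule assms(2)) simp
qed

section \<open>Extremal coordinates and products\<close>

lemma prod_le_power_card:
  fixes x :: "'n::finite \<Rightarrow> real"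
  assumes "\<And>j. j \<in> R \<Longrightarrow> 0 \<le> x j" "\<And>j. j \<in> R \<Longrightarrow> x j \<le> b"
  shows "(\<Prod>j\<in>R. x j) \<le> b ^ card R"
  using prod_mono[of R x "\<lambda>_. b"] assms by simp

lemma power_card_le_prod:
  fixes x :: "'n::finite \<Rightarrow> real"
  assumes "0 \<le> b" "\<And>j. j \<in> R \<Longrightarrow> b \<le> x j"
  shows "b ^ card R \<le> (\<Prod>j\<in>R. x j)"
  using prod_mono[of R "\<lambda>_. b" x] assms by simp

text \<open>
  If \<open>p \<notin> R\<close>, one of the factors bounded by \<open>b\<close> is given away to \<open>x p \<ge> b\<close>, so that the same bound
  holds whether or not the exceptional index occurs.
\<close>

lemma prod_le_one_large:
  fixes x :: "'n::finite \<Rightarrow> real"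
  assumes "\<And>j. 0 \<le> x j" "\<And>j. j \<noteq> p \<Longrightarrow> x j \<le> b" "b \<le> x p" "0 \<le> b" "card R = Suc k"
  shows "(\<Prod>j\<in>R. x j) \<le> x p * b ^ k"
proof (cases "p \<in> R")
  case True
  have "(\<Prod>j\<in>R - {p}. x j) \<le> b ^ card (R - {p})"
    using assms by (intro prod_le_power_card) auto
  with True assms show ?thesis
    by (simp add: prod.remove[of R p] mult_left_mono)
next
  case False
  have "(\<Prod>j\<in>R. x j) \<le> b ^ Suc k"
    using prod_le_power_card[of R x b] assms False by force
  also have "\<dots> \<le> x p * b ^ k"
    using assms(3,4) by (simp add: mult_right_mono)
  finally show ?thesis .
qed

lemma one_small_le_prod:
  fixes x :: "'n::finite \<Rightarrow> real"
  assumes "0 \<le> x p" "\<And>j. j \<noteq> p \<Longrightarrow> b \<le> x j" "x p \<le> b" "card R = Suc k"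
  shows "x p * b ^ k \<le> (\<Prod>j\<in>R. x j)"
proof (cases "p \<in> R")
  case True
  have "b ^ card (R - {p}) \<le> (\<Prod>j\<in>R - {p}. x j)"
    using assms by (intro power_card_le_prod) auto
  with True assms show ?thesis
    by (simp add: prod.remove[of R p] mult_left_mono)
next
  case False
  have "x p * b ^ k \<le> b ^ Suc k"
    using assms(1,3) by (simp add: mult_right_mono)
  also have "\<dots> \<le> (\<Prod>j\<in>R. x j)"
    using power_card_le_prod[of b R x] assms False by force
  finally show ?thesis .
qed

lemma obtain_two_largest:
  fixes y :: "'n::finite \<Rightarrow> real"
  assumes "CARD('n) \<ge> 2"
  obtains p q where "p \<noteq> q" "y q \<le> y p" "\<And>j. j \<noteq> p \<Longrightarrow> y j \<le> y q"
proof -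
  have "Max (range y) \<in> range y" by (rule Max_in) auto
  then obtain p where p: "Max (range y) = y p" by (rule imageE)
  have "card (UNIV - {p}) \<noteq> 0"
    using assms by (simp add: card_Diff_singleton)
  then have "UNIV - {p} \<noteq> {}" by (metis card.empty)
  then have "Max (y ` (UNIV - {p})) \<in> y ` (UNIV - {p})" by (intro Max_in) auto
  then obtain q where q: "Max (y ` (UNIV - {p})) = y q" "q \<in> UNIV - {p}" by (rule imageE)
  show ?thesis
  proof (rule that[of p q])
    show "p \<noteq> q" using q(2) by auto
    show "y q \<le> y p" unfolding p[symmetric] by simp
    show "y j \<le> y q" if "j \<noteq> p" for j unfolding q(1)[symmetric] using that by simp
  qed
qed

text \<open>
  The second inequality bounds \<open>c / d\<close> by \<open>t / s\<close>; raised to the power \<open>k\<close> and multiplied with the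
  first one, it makes \<open>s\<close> and \<open>t\<close> cancel. Stated without division, it needs no case distinction
  on \<open>d\<close>.
\<close>

lemma eliminate_ratio:
  fixes s t :: real
  assumes "a * t ^ k \<le> b * s ^ k" "c * s \<le> d * t" "0 < s" "0 < t" "0 \<le> b" "0 \<le> c"
  shows "a * c ^ k \<le> b * d ^ k"
proof -
  have "(c * s) ^ k \<le> (d * t) ^ k"
    using assms by (intro power_mono) auto
  with assms(1) have "(a * t ^ k) * (c * s) ^ k \<le> (b * s ^ k) * (d * t) ^ k"
    by (rule mult_mono) (use assms in simp_all)
  then have "(a * c ^ k) * (s * t) ^ k \<le> (b * d ^ k) * (s * t) ^ k"
    by (simp add: power_mult_distrib mult_ac)
  then show ?thesis using assms(3,4) by simp
qed

section \<open>Order statistics of the out-degrees\<close>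

lemma card_less_nth_sorted:
  assumes "sorted xs"
  shows "length (filter (\<lambda>a. a < xs ! k) xs) \<le> k"
proof -
  have "{i. i < length xs \<and> xs ! i < xs ! k} \<subseteq> {..<k}"
    using assms by (auto simp: sorted_iff_nth_mono) (metis leD linorder_not_less)
  then show ?thesis
    unfolding length_filter_conv_card by (metis card_lessThan card_mono finite_lessThan)
qed

lemma card_greater_nth_sorted:
  assumes "sorted xs" "k < length xs"
  shows "length (filter (\<lambda>a. xs ! k < a) xs) \<le> length xs - Suc k"
proof -
  have "{i. i < length xs \<and> xs ! k < xs ! i} \<subseteq> {Suc k..<length xs}"
    using assms by (auto simp: sorted_iff_nth_mono Suc_le_eq) (metis leD linorder_not_less)
  then show ?thesis
    unfolding length_filter_conv_card by (metis card_atLeastLessThan card_mono finite_atLeastLessThan)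
qed

abbreviation out_degree_list :: "'n::finite dedge set \<Rightarrow> nat list" where
  "out_degree_list E \<equiv> sorted_list_of_multiset (image_mset (out_degree E) (mset_set UNIV))"

lemma length_out_degree_list: "length (out_degree_list (E :: 'n::finite dedge set)) = CARD('n)"
  by (metis mset_sorted_list_of_multiset size_image_mset size_mset size_mset_set)

lemma length_filter_out_degree_list:
  fixes E :: "'n::finite dedge set"
  shows "length (filter P (out_degree_list E)) = card {v. P (out_degree E v)}"
proof -
  have "length (filter P (out_degree_list E)) = size (filter_mset P (mset (out_degree_list E)))"
    by (metis mset_filter size_mset)
  also have "\<dots> = size (filter_mset P (image_mset (out_degree E) (mset_set UNIV)))"
    by simp
  also have "\<dots> = card {v. P (out_degree E v)}"
    by (simp add: filter_mset_image_mset)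
  finally show ?thesis .
qed

text \<open>
  Only the first entry of the sorted list can lie strictly below the second one.
\<close>

lemma second_smallest_out_degree_le:
  assumes "p \<noteq> q"
  shows "nth_out_degree E 2 \<le> out_degree E p \<or> nth_out_degree E 2 \<le> out_degree E q"
proof (rule ccontr)
  let ?d = "nth_out_degree E 2"
  assume "\<not> ?thesis"
  then have "{p, q} \<subseteq> {v. out_degree E v < ?d}" by auto
  then have "card {p, q} \<le> card {v. out_degree E v < ?d}" by (intro card_mono) auto
  moreover have "card {v. out_degree E v < ?d} \<le> 1"
    using card_less_nth_sorted[of "out_degree_list E" 1]
    by (simp add: length_filter_out_degree_list nth_out_degree_def)
  ultimately show False using assms by simp
qed

text \<open>
  Only the last entry of the sorted list can lie strictly above the last but one.
\<close>

lemma second_largest_out_degree_ge: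
  fixes E :: "'n::finite dedge set"
  assumes "p \<noteq> q" "CARD('n) \<ge> 2"
  shows "out_degree E p \<le> nth_out_degree E (CARD('n) - 1)
       \<or> out_degree E q \<le> nth_out_degree E (CARD('n) - 1)"
proof (rule ccontr)
  let ?d = "nth_out_degree E (CARD('n) - 1)"
  assume "\<not> ?thesis"
  then have "{p, q} \<subseteq> {v. ?d < out_degree E v}" by auto
  then have "card {p, q} \<le> card {v. ?d < out_degree E v}" by (intro card_mono) auto
  moreover have "card {v. ?d < out_degree E v} \<le> 1"
    using card_greater_nth_sorted[of "out_degree_list E" "CARD('n) - 2"] assms(2)
    by (simp add: length_filter_out_degree_list length_out_degree_list nth_out_degree_def
        numeral_2_eq_2)
  ultimately show False using assms by simp
qed

lemma nth_out_degree_in_range: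
  fixes E :: "'n::finite dedge set"
  assumes "1 \<le> j" "j \<le> CARD('n)"
  shows "nth_out_degree E j \<in> range (out_degree E)"
proof -
  have "nth_out_degree E j \<in> set (out_degree_list E)"
    unfolding nth_out_degree_def using assms by (intro nth_mem) (simp add: length_out_degree_list)
  then show ?thesis by simp
qed

lemma min_out_degree_le: "min_out_degree E \<le> out_degree E v"
  by (simp add: min_out_degree_def)

lemma out_degree_le_max: "out_degree E v \<le> max_out_degree E"
  by (simp add: max_out_degree_def)

text \<open>
  The product bound is not enough when \<open>q\<close> is the only vertex whose degree lies below the second
  smallest one: the small degree would then occur with exponent \<open>m - 1\<close>. In that case \<open>p\<close> has at
  least the second smallest degree, and \<open>d\<^sub>p \<le> l\<close> alone gives the claim.
\<close>

lemma degree_product_ge: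
  fixes E :: "'n::finite dedge set"
  assumes "p \<noteq> q" "CARD('n) \<ge> 2" "0 \<le> l" "m \<ge> 1"
    and "real (out_degree E p) * real (out_degree E q) ^ (m - 1) \<le> l ^ m"
    and "real (out_degree E p) \<le> l"
  shows "real (min_out_degree E) * real (nth_out_degree E 2) ^ (m - 1) \<le> l ^ m"
proof (cases "nth_out_degree E 2 \<le> out_degree E q")
  case True
  have "real (min_out_degree E) * real (nth_out_degree E 2) ^ (m - 1)
      \<le> real (out_degree E p) * real (out_degree E q) ^ (m - 1)"
    using True by (intro mult_mono power_mono) (auto simp: min_out_degree_le)
  with assms(5) show ?thesis by linarith
next
  case False
  then have p: "real (nth_out_degree E 2) \<le> l"
    using second_smallest_out_degree_le[OF assms(1), of E] assms(6) by linarith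
  have "nth_out_degree E 2 \<in> range (out_degree E)"
    using assms(2) by (intro nth_out_degree_in_range) auto
  then have "min_out_degree E \<le> nth_out_degree E 2"
    using min_out_degree_le by auto
  then have "real (min_out_degree E) * real (nth_out_degree E 2) ^ (m - 1) \<le> l * l ^ (m - 1)"
    using p assms(3) by (intro mult_mono power_mono) auto
  also have "\<dots> = l ^ m" using assms(4) by (cases m) auto
  finally show ?thesis .
qed

text \<open>
  The mirror image of \<open>degree_product_ge\<close>: when \<open>q\<close> is the only vertex whose degree lies above the
  second largest one, the claim comes from \<open>l \<le> d\<^sub>p\<close>.
\<close>

lemma degree_product_le:
  fixes E :: "'n::finite dedge set"
  assumes "p \<noteq> q" "CARD('n) \<ge> 2" "0 \<le> l" "m \<ge> 1"
    and "l ^ m \<le> real (out_degree E p) * real (out_degree E q) ^ (m - 1)"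
    and "l \<le> real (out_degree E p)"
  shows "l ^ m \<le> real (max_out_degree E) * real (nth_out_degree E (CARD('n) - 1)) ^ (m - 1)"
proof (cases "out_degree E q \<le> nth_out_degree E (CARD('n) - 1)")
  case True
  have "real (out_degree E p) * real (out_degree E q) ^ (m - 1)
      \<le> real (max_out_degree E) * real (nth_out_degree E (CARD('n) - 1)) ^ (m - 1)"
    using True by (intro mult_mono power_mono) (auto simp: out_degree_le_max)
  with assms(5) show ?thesis by linarith
next
  case False
  then have p: "l \<le> real (nth_out_degree E (CARD('n) - 1))"
    using second_largest_out_degree_ge[OF assms(1,2), of E] assms(6) by linarith
  have "l \<le> real (max_out_degree E)"
    using assms(6) out_degree_le_max[of E p] by linarith
  with p have "l * l ^ (m - 1)
      \<le> real (max_out_degree E) * real (nth_out_degree E (CARD('n) - 1)) ^ (m - 1)"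
    using assms(3) by (intro mult_mono power_mono) auto
  moreover have "l * l ^ (m - 1) = l ^ m" using assms(4) by (cases m) auto
  ultimately show ?thesis by simp
qed

section \<open>The upper bound\<close>

text \<open>
  The equations for the two coordinates of largest modulus are compared; \<open>degree_product_le\<close>
  accounts for which of these vertices has the larger degree.
\<close>

lemma eigenvalue_power_le:
  fixes E :: "'n::finite dedge set"
  assumes E: "directed_hypergraph E" "uniform_hypergraph m E" and n: "CARD('n) \<ge> 2" and m: "m \<ge> 2"
    and ev: "hm_eigenvalue m (out_adjacency m E) l"
  shows "cmod l ^ m \<le> real (max_out_degree E) * real (nth_out_degree E (CARD('n) - 1)) ^ (m - 1)"
proof -
  obtain x where x0: "x \<noteq> 0"
    and x: "\<And>i. edge_poly E (\<lambda>j. x $ j) i = l * (x $ i) ^ (m - 1)"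
    using ev unfolding hm_eigenvalue_out_adjacency_iff[OF E] by blast
  define y where "y = (\<lambda>j. cmod (x $ j))"
  obtain k where k: "m = Suc (Suc k)" using m by (metis Suc_le_D numeral_2_eq_2 Suc_le_mono)
  have y0: "0 \<le> y j" for j by (simp add: y_def)
  have ey: "cmod l * y i ^ (m - 1) \<le> edge_poly E y i" for i
    using norm_edge_poly_le[of E "\<lambda>j. x $ j" i] unfolding x y_def by (simp add: norm_mult norm_power)
  obtain p q where pq: "p \<noteq> q" "y q \<le> y p" "\<And>j. j \<noteq> p \<Longrightarrow> y j \<le> y q"
    using obtain_two_largest[OF n, of y] by blast
  have yp: "0 < y p"
  proof -
    obtain i where "x $ i \<noteq> 0" using x0 by (auto simp: vec_eq_iff)
    then have "0 < y i" by (simp add: y_def)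
    then show ?thesis using pq(2) pq(3)[of i] by (cases "i = p") auto
  qed
  have "edge_poly E y p \<le> real (out_degree E p) * y q ^ (m - 1)"
  proof (rule edge_poly_le[OF E(2)])
    fix R assume "card R = m - 1" "p \<notin> R"
    then show "(\<Prod>j\<in>R. y j) \<le> y q ^ (m - 1)"
      using prod_le_power_card[of R y "y q"] y0 pq(3) by metis
  qed
  with ey[of p] have lp: "cmod l * y p ^ (m - 1) \<le> real (out_degree E p) * y q ^ (m - 1)"
    by linarith
  have "edge_poly E y q \<le> real (out_degree E q) * (y p * y q ^ k)"
    using prod_le_one_large[of y p "y q" _ k] y0 pq k by (intro edge_poly_le[OF E(2)]) auto
  with ey[of q] have lq: "cmod l * y q ^ (m - 1) \<le> real (out_degree E q) * (y p * y q ^ k)"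
    by (meson order_trans)
  have "cmod l * y p ^ (m - 1) \<le> real (out_degree E p) * y p ^ (m - 1)"
    using lp pq(2) y0[of q] by (meson mult_left_mono of_nat_0_le_iff order_trans power_mono)
  then have ld: "cmod l \<le> real (out_degree E p)"
    using yp by simp
  have "cmod l ^ m \<le> real (out_degree E p) * real (out_degree E q) ^ (m - 1)"
    \<comment> \<open>Equation \<open>q\<close> can be divided by \<open>y q\<close> only if that is nonzero; otherwise equation \<open>p\<close> forces
       \<open>l = 0\<close>, since \<open>m \<ge> 2\<close>.\<close>
  proof (cases "y q = 0")
    case True
    then have "cmod l * y p ^ (m - 1) \<le> 0" using lp k by simp
    then have "l = 0" using zero_less_power[OF yp, of "m - 1"] by (simp add: mult_le_0_iff)
    then show ?thesis using k by simp
  next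
    case False
    then have yq: "0 < y q" using y0[of q] by simp
    have "(cmod l * y q) * y q ^ k \<le> (real (out_degree E q) * y p) * y q ^ k"
      using lq k by (simp add: mult_ac)
    then have "cmod l * y q \<le> real (out_degree E q) * y p" using yq by simp
    then have "cmod l * cmod l ^ (m - 1) \<le> real (out_degree E p) * real (out_degree E q) ^ (m - 1)"
      by (rule eliminate_ratio[OF lp]) (use yp yq in auto)
    then show ?thesis using k by simp
  qed
  then show ?thesis
    using ld pq(1) n m by (intro degree_product_le[where p = p and q = q]) auto
qed

section \<open>The lower bound\<close>

text \<open>
  The factor that returns the coordinatewise \<open>k\<close>-th root of the perturbed map to the simplex. At a
  fixed point its \<open>k\<close>-th power is the eigenvalue; being continuous in \<open>x\<close> and \<open>c\<close>, it ensures that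
  the eigenvalues converge together with the eigenvectors.
\<close>

definition root_scale :: "'n::finite dedge set \<Rightarrow> nat \<Rightarrow> real \<Rightarrow> real ^ 'n \<Rightarrow> real" where
  "root_scale E k c x = (\<Sum>j\<in>UNIV. root k (edge_poly E (\<lambda>i. x $ i) j + c))"

definition std_simplex :: "(real ^ 'n::finite) set" where
  "std_simplex = {x. (\<forall>i. 0 \<le> x $ i) \<and> (\<Sum>i\<in>UNIV. x $ i) = 1}"

lemma compact_std_simplex: "compact (std_simplex :: (real ^ 'n::finite) set)"
proof -
  have "bounded (std_simplex :: (real ^ 'n) set)"
  proof (rule boundedI)
    fix x :: "real ^ 'n" assume "x \<in> std_simplex"
    then show "norm x \<le> 1"
      using norm_le_l1_cart[of x] by (simp add: std_simplex_def)
  qed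
  moreover have "closed (std_simplex :: (real ^ 'n) set)"
    unfolding std_simplex_def
    by (intro closed_Collect_conj closed_Collect_all closed_Collect_le closed_Collect_eq
        continuous_intros)
  ultimately show ?thesis by (simp add: compact_eq_bounded_closed)
qed

lemma convex_std_simplex: "convex (std_simplex :: (real ^ 'n::finite) set)"
  unfolding convex_def std_simplex_def
  by (auto simp: sum.distrib sum_distrib_left[symmetric])

lemma std_simplex_nonempty: "(std_simplex :: (real ^ 'n::finite) set) \<noteq> {}"
proof -
  have "axis undefined 1 \<in> (std_simplex :: (real ^ 'n) set)"
    by (auto simp: std_simplex_def axis_def)
  then show ?thesis by blast
qed

text \<open>
  A fixed point of the map \<open>x \<mapsto> (F x)\<^sup>1\<^sup>/\<^sup>k\<close>, rescaled to coordinate sum \<open>1\<close>, is an eigenvector of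
  \<open>F\<close>. The constant \<open>c\<close> keeps \<open>F\<close> positive on the whole simplex, so the map is well defined there and
  its fixed points have no zero coordinate.
\<close>

lemma perturbed_positive_eigenvector:
  fixes E :: "'n::finite dedge set"
  assumes "k \<ge> 1" "c > 0"
  obtains x where "x \<in> std_simplex" "\<And>i. 0 < x $ i" "0 < root_scale E k c x"
    "\<And>i. edge_poly E (\<lambda>i. x $ i) i + c = root_scale E k c x ^ k * (x $ i) ^ k"
proof -
  let ?g = "\<lambda>x i. root k (edge_poly E (\<lambda>i. x $ i) i + c)"
  have g: "0 < ?g x i" if "x \<in> std_simplex" for x i
    using that assms edge_poly_nonneg[of "\<lambda>i. x $ i" E i]
    by (simp add: std_simplex_def add_nonneg_pos)
  have s: "0 < root_scale E k c x" if "x \<in> std_simplex" for x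
    unfolding root_scale_def using g[OF that] by (intro sum_pos) auto
  have "\<exists>x\<in>std_simplex. (\<chi> i. ?g x i / root_scale E k c x) = x"
  proof (rule brouwer[OF compact_std_simplex convex_std_simplex std_simplex_nonempty])
    have cg: "continuous_on std_simplex (\<lambda>x. ?g x i)" for i
      by (intro continuous_on_real_root continuous_on_add continuous_on_edge_poly continuous_intros)
    have cs: "continuous_on std_simplex (root_scale E k c)"
      unfolding root_scale_def by (intro continuous_on_sum cg)
    have "root_scale E k c x \<noteq> 0" if "x \<in> std_simplex" for x
      using s[OF that] by simp
    then show "continuous_on std_simplex (\<lambda>x. \<chi> i. ?g x i / root_scale E k c x)"
      by (intro continuous_on_vec_lambda continuous_on_divide cg cs) auto
    show "(\<lambda>x. \<chi> i. ?g x i / root_scale E k c x) \<in> std_simplex \<rightarrow> std_simplex"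
    proof
      fix x :: "real ^ 'n" assume x: "x \<in> std_simplex"
      have "(\<Sum>i\<in>UNIV. ?g x i / root_scale E k c x) = 1"
        using s[OF x] by (simp add: sum_divide_distrib[symmetric] root_scale_def)
      then show "(\<chi> i. ?g x i / root_scale E k c x) \<in> std_simplex"
        using s[OF x] g[OF x] by (simp add: std_simplex_def less_imp_le)
    qed
  qed blast
  then obtain x where x: "x \<in> std_simplex" "(\<chi> i. ?g x i / root_scale E k c x) = x" by blast
  have xi: "x $ i = ?g x i / root_scale E k c x" for i
    using x(2) by (metis vec_lambda_beta)
  show ?thesis
  proof (rule that[OF x(1)])
    show "0 < x $ i" for i using s[OF x(1)] g[OF x(1), of i] xi[of i] by simp
    show "0 < root_scale E k c x" by (rule s[OF x(1)])
    show "edge_poly E (\<lambda>i. x $ i) i + c = root_scale E k c x ^ k * (x $ i) ^ k" for i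
    proof -
      have "root_scale E k c x * x $ i = ?g x i" using xi[of i] s[OF x(1)] by simp
      then have "(root_scale E k c x * x $ i) ^ k = ?g x i ^ k" by simp
      also have "\<dots> = edge_poly E (\<lambda>i. x $ i) i + c"
        using assms edge_poly_nonneg[of "\<lambda>i. x $ i" E i] x(1)
        by (intro real_root_pow_pos2) (auto simp: std_simplex_def)
      finally show ?thesis by (simp add: power_mult_distrib)
    qed
  qed
qed

text \<open>
  The argument of \<open>eigenvalue_power_le\<close> with the two smallest coordinates. An inequality is
  assumed in place of the eigenvalue equation because the perturbed eigenvectors satisfy nothing
  better for the unperturbed polynomial.
\<close>

lemma positive_supersolution_power_ge:
  fixes E :: "'n::finite dedge set" and x :: "'n \<Rightarrow> real"
  assumes E: "uniform_hypergraph m E" and n: "CARD('n) \<ge> 2" and m: "m \<ge> 2"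
    and x0: "\<And>i. 0 < x i" and l: "0 \<le> l"
    and x: "\<And>i. edge_poly E x i \<le> l * x i ^ (m - 1)"
  shows "real (min_out_degree E) * real (nth_out_degree E 2) ^ (m - 1) \<le> l ^ m"
proof -
  obtain k where k: "m = Suc (Suc k)" using m by (metis Suc_le_D numeral_2_eq_2 Suc_le_mono)
  \<comment> \<open>The two largest values of \<open>- x\<close> are the two smallest values of \<open>x\<close>.\<close>
  obtain p q where pq: "p \<noteq> q" "x p \<le> x q" "\<And>j. j \<noteq> p \<Longrightarrow> x q \<le> x j"
    using obtain_two_largest[OF n, of "\<lambda>i. - x i"] by auto
  have "real (out_degree E p) * x q ^ (m - 1) \<le> edge_poly E x p"
  proof (rule edge_poly_ge[OF E])
    fix R assume "card R = m - 1" "p \<notin> R"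
    then show "x q ^ (m - 1) \<le> (\<Prod>j\<in>R. x j)"
      using power_card_le_prod[of "x q" R x] x0 pq(3) by (metis less_imp_le)
  qed
  with x[of p] have lp: "real (out_degree E p) * x q ^ (m - 1) \<le> l * x p ^ (m - 1)"
    by linarith
  have "real (out_degree E q) * (x p * x q ^ k) \<le> edge_poly E x q"
    using one_small_le_prod[of x p "x q" _ k] x0 pq k
    by (intro edge_poly_ge[OF E]) (auto simp: less_imp_le)
  with x[of q] have lq: "real (out_degree E q) * (x p * x q ^ k) \<le> l * x q ^ (m - 1)"
    by (meson order_trans)
  have "real (out_degree E p) * x q ^ (m - 1) \<le> l * x q ^ (m - 1)"
    using lp pq(2) x0[of p] l by (meson mult_left_mono order_trans power_mono less_imp_le)
  then have ld: "real (out_degree E p) \<le> l"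
    using x0[of q] by simp
  have "(real (out_degree E q) * x p) * x q ^ k \<le> (l * x q) * x q ^ k"
    using lq k by (simp add: mult_ac)
  then have "real (out_degree E q) * x p \<le> l * x q" using x0[of q] by simp
  then have "real (out_degree E p) * real (out_degree E q) ^ (m - 1) \<le> l * l ^ (m - 1)"
    by (rule eliminate_ratio[OF lp]) (use x0 l in auto)
  then have "real (out_degree E p) * real (out_degree E q) ^ (m - 1) \<le> l ^ m"
    using k by simp
  then show ?thesis
    using ld pq(1) n m l by (intro degree_product_ge[where p = p and q = q]) auto
qed

text \<open>
  The bound holds uniformly in the perturbation, hence survives the limit even though the limiting
  eigenvector may have zero coordinates.
\<close>

lemma exists_large_eigenvalue:
  fixes E :: "'n::finite dedge set"
  assumes E: "directed_hypergraph E" "uniform_hypergraph m E" and n: "CARD('n) \<ge> 2" and m: "m \<ge> 2"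
  obtains l where "hm_eigenvalue m (out_adjacency m E) l"
    "real (min_out_degree E) * real (nth_out_degree E 2) ^ (m - 1) \<le> cmod l ^ m"
proof -
  let ?B = "real (min_out_degree E) * real (nth_out_degree E 2) ^ (m - 1)"
  let ?c = "\<lambda>t. inverse (real (Suc t))"
  have "\<exists>x. x \<in> std_simplex \<and> (\<forall>i. 0 < x $ i) \<and> 0 < root_scale E (m - 1) (?c t) x \<and>
      (\<forall>i. edge_poly E (\<lambda>i. x $ i) i + ?c t
        = root_scale E (m - 1) (?c t) x ^ (m - 1) * (x $ i) ^ (m - 1))" for t
    using m by (rule_tac perturbed_positive_eigenvector[of "m - 1" "?c t" E]) auto
  then obtain X where X: "\<And>t. X t \<in> std_simplex" "\<And>t i. 0 < X t $ i"
    "\<And>t. 0 < root_scale E (m - 1) (?c t) (X t)"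
    "\<And>t i. edge_poly E (\<lambda>i. X t $ i) i + ?c t
        = root_scale E (m - 1) (?c t) (X t) ^ (m - 1) * (X t $ i) ^ (m - 1)"
    by metis
  obtain x r where x: "x \<in> std_simplex" and r: "strict_mono r" and lim: "(X \<circ> r) \<longlonglongrightarrow> x"
    using compact_std_simplex X(1) unfolding compact_def by metis
  have limx: "(\<lambda>t. X (r t) $ i) \<longlonglongrightarrow> x $ i" for i
    using tendsto_vec_nth[OF lim] by (simp add: o_def)
  have limc: "(\<lambda>t. ?c (r t)) \<longlonglongrightarrow> 0"
    using LIMSEQ_subseq_LIMSEQ[OF LIMSEQ_inverse_real_of_nat r] by (simp add: o_def)
  have lime: "(\<lambda>t. edge_poly E (\<lambda>i. X (r t) $ i) i + ?c (r t)) \<longlonglongrightarrow> edge_poly E (\<lambda>i. x $ i) i" for i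
    using tendsto_add[OF tendsto_edge_poly[where f = "\<lambda>t i. X (r t) $ i", OF limx] limc] by simp
  let ?s = "\<lambda>t. root_scale E (m - 1) (?c (r t)) (X (r t)) ^ (m - 1)"
  define l where "l = root_scale E (m - 1) 0 x ^ (m - 1)"
  have liml: "?s \<longlonglongrightarrow> l"
    unfolding root_scale_def l_def add_0_right
    by (intro tendsto_power tendsto_sum tendsto_real_root lime)
  have eq: "edge_poly E (\<lambda>i. x $ i) i = l * (x $ i) ^ (m - 1)" for i
  proof (rule LIMSEQ_unique[OF lime])
    show "(\<lambda>t. edge_poly E (\<lambda>i. X (r t) $ i) i + ?c (r t)) \<longlonglongrightarrow> l * (x $ i) ^ (m - 1)"
      unfolding X(4) by (intro tendsto_mult tendsto_power limx liml)
  qed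
  have B: "?B \<le> ?s t ^ m" for t
  proof (rule positive_supersolution_power_ge[OF E(2) n m])
    show "0 < X (r t) $ i" for i by (rule X(2))
    show "0 \<le> ?s t" using X(3)[of "r t"] by simp
    have "edge_poly E (\<lambda>i. X (r t) $ i) i \<le> edge_poly E (\<lambda>i. X (r t) $ i) i + ?c (r t)" for i
      by simp
    then show "edge_poly E (\<lambda>i. X (r t) $ i) i \<le> ?s t * (X (r t) $ i) ^ (m - 1)" for i
      unfolding X(4) .
  qed
  have Bl: "?B \<le> l ^ m"
    by (rule LIMSEQ_le_const[OF tendsto_power[OF liml]]) (use B in auto)
  have l0: "0 \<le> l"
    by (rule LIMSEQ_le_const[OF liml]) (use X(3) in \<open>auto intro!: less_imp_le\<close>)
  show ?thesis
  proof (rule that[of "of_real l"])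
    have "\<exists>i. x $ i \<noteq> 0"
      using x unfolding std_simplex_def by (metis (mono_tags, lifting) mem_Collect_eq sum.neutral zero_neq_one)
    then have "(\<chi> i. complex_of_real (x $ i)) \<noteq> 0"
      by (auto simp: vec_eq_iff)
    moreover have "($) (\<chi> i. complex_of_real (x $ i)) = (\<lambda>j. complex_of_real (x $ j))"
      by (simp add: fun_eq_iff)
    moreover have "edge_poly E (\<lambda>j. complex_of_real (x $ j)) i
        = of_real l * of_real (x $ i) ^ (m - 1)" for i
      unfolding edge_poly_of_real eq by simp
    ultimately show "hm_eigenvalue m (out_adjacency m E) (of_real l)"
      unfolding hm_eigenvalue_out_adjacency_iff[OF E]
      by (intro exI[of _ "\<chi> i. complex_of_real (x $ i)"]) simp
    show "?B \<le> cmod (of_real l) ^ m" using Bl l0 by simp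
  qed
qed

section \<open>The spectral radius is attained\<close>

text \<open>
  By homogeneity the eigenvalues are the second components of the eigenpairs whose eigenvector has
  norm \<open>1\<close>. Given an a priori bound on the eigenvalues these pairs form a compact set, on which the
  modulus of the eigenvalue attains its maximum.
\<close>

lemma spectral_radius_attained:
  fixes E :: "'n::finite dedge set"
  assumes E: "directed_hypergraph E" "uniform_hypergraph m E"
    and ex: "hm_eigenvalue m (out_adjacency m E) l0"
    and bd: "\<And>l. hm_eigenvalue m (out_adjacency m E) l \<Longrightarrow> cmod l \<le> U"
  shows "\<exists>l. hm_eigenvalue m (out_adjacency m E) l \<and> hm_spectral_radius m (out_adjacency m E) = cmod l"
    and "hm_eigenvalue m (out_adjacency m E) l \<Longrightarrow> cmod l \<le> hm_spectral_radius m (out_adjacency m E)"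
proof -
  let ?ev = "hm_eigenvalue m (out_adjacency m E)"
  define K :: "((complex ^ 'n) \<times> complex) set" where
    "K = (sphere 0 1 \<times> cball 0 U) \<inter>
      {z. \<forall>i. edge_poly E (\<lambda>j. fst z $ j) i = snd z * (fst z $ i) ^ (m - 1)}"
  have "compact K"
    unfolding K_def
    by (intro compact_Int_closed compact_Times compact_sphere compact_cball closed_Collect_all
        closed_Collect_eq continuous_on_edge_poly continuous_intros)
  have Kev: "?ev l \<longleftrightarrow> (\<exists>x. (x, l) \<in> K)" for l
  proof
    assume "?ev l"
    then have lU: "cmod l \<le> U" by (rule bd)
    obtain x where x: "x \<noteq> 0" "\<And>i. edge_poly E (\<lambda>j. x $ j) i = l * (x $ i) ^ (m - 1)"
      using \<open>?ev l\<close> unfolding hm_eigenvalue_out_adjacency_iff[OF E] by blast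
    define c where "c = complex_of_real (inverse (norm x))"
    define u where "u = inverse (norm x) *\<^sub>R x"
    have "norm u = 1" using x(1) by (simp add: u_def)
    moreover have "($) u = (\<lambda>j. c * x $ j)"
      unfolding u_def c_def fun_eq_iff vector_scaleR_component
      by (simp add: scaleR_conv_of_real[where 'a = complex])
    ultimately have "(u, l) \<in> K"
      using lU x(2) by (simp add: K_def edge_poly_scale[OF E(2)] power_mult_distrib)
    then show "\<exists>x. (x, l) \<in> K" ..
  next
    assume "\<exists>x. (x, l) \<in> K"
    then obtain x where x: "(x, l) \<in> K" ..
    then have "x \<noteq> 0" by (auto simp: K_def)
    with x show "?ev l"
      unfolding hm_eigenvalue_out_adjacency_iff[OF E] K_def by auto
  qed
  have "K \<noteq> {}" using ex Kev by blast
  moreover have "continuous_on K (\<lambda>w. cmod (snd w))" by (intro continuous_intros)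
  ultimately obtain z where z: "z \<in> K" "\<And>w. w \<in> K \<Longrightarrow> cmod (snd w) \<le> cmod (snd z)"
    using continuous_attains_sup[OF \<open>compact K\<close>] by metis
  have ev: "?ev (snd z)" using z(1) Kev by (metis prod.collapse)
  have le: "cmod l \<le> cmod (snd z)" if "?ev l" for l
    using that z(2) Kev by (metis snd_conv)
  have "hm_spectral_radius m (out_adjacency m E) = cmod (snd z)"
    unfolding hm_spectral_radius_def
    by (rule Greatest_equality) (use ev le in auto)
  then show "\<exists>l. ?ev l \<and> hm_spectral_radius m (out_adjacency m E) = cmod l"
    and "?ev l \<Longrightarrow> cmod l \<le> hm_spectral_radius m (out_adjacency m E)"
    using ev le by auto
qed

section \<open>Bounds on the spectral radius\<close>

lemma weighted_geometric_mean_power: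
  fixes a b :: real
  assumes "0 \<le> a" "0 \<le> b" "m \<ge> 2"
  shows "(a powr (1 / real m) * b powr (1 - 1 / real m)) ^ m = a * b ^ (m - 1)"
proof (cases "a = 0 \<or> b = 0")
  case True
  then show ?thesis using assms by (auto simp: power_0_left)
next
  case False
  then have "0 < a" "0 < b" using assms by auto
  moreover have "real m * (1 - 1 / real m) = real (m - 1)"
    using assms by (simp add: field_simps)
  ultimately show ?thesis
    using assms by (simp add: power_mult_distrib powr_realpow[symmetric] powr_powr mult.commute)
qed

theorem theorem4:
  fixes m :: nat and E :: "'n::finite dedge set"
  assumes "m \<ge> 1" and "CARD('n) \<ge> 2"
    and "directed_hypergraph E" and "uniform_hypergraph m E"
  shows "real (min_out_degree E) powr (1 / real m)
           * real (nth_out_degree E 2) powr (1 - 1 / real m)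
         \<le> hm_spectral_radius m (out_adjacency m E)
       \<and> hm_spectral_radius m (out_adjacency m E)
         \<le> real (max_out_degree E) powr (1 / real m)
           * real (nth_out_degree E (CARD('n) - 1)) powr (1 - 1 / real m)"
    (is "?lower \<le> ?rho \<and> ?rho \<le> ?upper")
proof (cases "m = 1")
  case True
  \<comment> \<open>An edge has at least two vertices, as its head and tail are disjoint and nonempty.\<close>
  have "E = {}"
  proof (rule ccontr)
    assume "E \<noteq> {}"
    then obtain T H where "(T, H) \<in> E" by auto
    then have TH: "T \<noteq> {}" "H \<noteq> {}" "T \<inter> H = {}" "card (T \<union> H) = 1"
      using assms(3,4) True by (auto simp: directed_hypergraph_def uniform_hypergraph_def)
    then have "card T + card H = 1" by (simp add: card_Un_disjoint)
    moreover have "card T > 0" "card H > 0" using TH by (auto simp: card_gt_0_iff)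
    ultimately show False by linarith
  qed
  then have deg: "out_degree E v = 0" for v by (simp add: out_degree_def)
  have ev: "hm_eigenvalue m (out_adjacency m E) l \<longleftrightarrow> l = 0" for l
    unfolding hm_eigenvalue_out_adjacency_iff[OF assms(3,4)] using True \<open>E = {}\<close>
    by (auto simp: edge_poly_def intro: exI[of _ 1])
  have "?rho = 0"
    unfolding hm_spectral_radius_def ev by (rule Greatest_equality) auto
  moreover have "min_out_degree E = 0" "max_out_degree E = 0"
    by (simp_all add: min_out_degree_def max_out_degree_def deg)
  ultimately show ?thesis by simp
next
  case False
  then have m: "m \<ge> 2" using assms(1) by simp
  let ?ev = "hm_eigenvalue m (out_adjacency m E)"
  note mean = weighted_geometric_mean_power[OF of_nat_0_le_iff of_nat_0_le_iff m]
  have up: "cmod l \<le> ?upper" if "?ev l" for l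
  proof (rule power_le_imp_le_base)
    show "cmod l ^ Suc (m - 1) \<le> ?upper ^ Suc (m - 1)"
      using eigenvalue_power_le[OF assms(3,4,2) m that] m by (simp add: mean)
  qed simp
  obtain l where l: "?ev l"
    "real (min_out_degree E) * real (nth_out_degree E 2) ^ (m - 1) \<le> cmod l ^ m"
    using exists_large_eigenvalue[OF assms(3,4,2) m] .
  have lo: "?lower \<le> cmod l"
  proof (rule power_le_imp_le_base)
    show "?lower ^ Suc (m - 1) \<le> cmod l ^ Suc (m - 1)"
      using l(2) m by (simp add: mean)
  qed simp
  obtain l' where "?ev l'" "?rho = cmod l'"
    using spectral_radius_attained(1)[OF assms(3,4) l(1) up] by blast
  moreover have "cmod l \<le> ?rho"
    by (rule spectral_radius_attained(2)[OF assms(3,4) l(1) up l(1)])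
  ultimately show ?thesis
    using lo up[of l'] by linarith
qed

end
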